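(* Any abelian DG-category is idempotent-complete, and all twists exist in it.
   Context: Gradings: fix an abelian group $\Gamma$, a symmetric bilinear form $\sigma\colon\Gamma\times\Gamma\to\mathbb Z/2$ and an element $\mathbf 1\in\Gamma$ with $\sigma(\mathbf 1,\mathbf 1)=1$; complexes are $\Gamma$-graded with differentials of degree $\mathbf 1$ (an integer $n$ denotes $n\cdot\mathbf 1$; $(-1)^i$ means $(-1)^{\sigma(\mathbf 1,i)}$), with the Koszul sign rule (standard case: $\Gamma=\mathbb Z$). A DG-category $\mathbf A$ is a category enriched in complexes of abelian groups; $\mathsf Z^0(\mathbf A)$ is the preadditive category with the same objects and the degree-$0$ cocycles (closed morphisms of degree $0$) as morphisms; $\mathbf A$ is additive, resp. idempotent-complete, if $\mathsf Z^0(\mathbf A)$ is. Shift $X[i]$: an object with mutually inverse closed morphisms in $\operatorname{Hom}^{-i}_{\mathbf A}(X,X[i])$ and $\operatorname{Hom}^{i}_{\mathbf A}(X[i],X)$. The cone of a closed degree-$0$ morphism $f\colon X\to Y$ is an object representing, functorially in $Z$, the cone of $\operatorname{Hom}^\bullet_{\mathbf A}(Z,X)\to\operatorname{Hom}^\bullet_{\mathbf A}(Z,Y)$. Twists: given $X\in\mathbf A$ and $a\in\operatorname{Hom}^1_{\mathbf A}(X,X)$ with $d(a)+a^2=0$, the twist $X(a)$ is an object $Y$ with mutually inverse $f\in\operatorname{Hom}^0_{\mathbf A}(X,Y)$ and $g\in\operatorname{Hom}^0_{\mathbf A}(Y,X)$ such that $d(f)=fa$. The DG-category $\mathbf A^\natural$: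 objects are pairs $(X,\sigma_X)$ with $X\in\mathbf A$, $\sigma_X\in\operatorname{Hom}^{-1}_{\mathbf A}(X,X)$, $d(\sigma_X)=\mathrm{id}_X$, $\sigma_X^2=0$; $\operatorname{Hom}^i_{\mathbf A^\natural}((X,\sigma_X),(Y,\sigma_Y))$ is the group of closed morphisms $X\to Y$ of degree $-i$ in $\mathbf A$, with differential $d^\natural(f)=\sigma_Yf-(-1)^if\sigma_X$. An abelian DG-category is an additive DG-category $\mathbf A$ with shifts and cones such that both additive categories $\mathsf Z^0(\mathbf A)$ and $\mathsf Z^0(\mathbf A^\natural)$ are abelian. *)

theory Defs
  imports "HOL-Algebra.Group" "HOL-Library.Z2"
begin

text \<open>
  Hom groups are abelian groups in the sense of HOL-Algebra, hence written multiplicatively: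
  \<open>\<otimes>\<close> is addition, \<open>\<one>\<close> is zero and \<open>inv\<close> is negation of morphisms.
  Composition is a separate operation, written in the order \<open>comp \<dots> g f\<close> for \<open>g\<close> after \<open>f\<close>.
\<close>

section \<open>Preadditive, additive and abelian categories\<close>

record ('o, 'm) precat =
  Obj :: "'o set"
  Hom :: "'o \<Rightarrow> 'o \<Rightarrow> 'm monoid"
  Comp :: "'o \<Rightarrow> 'o \<Rightarrow> 'o \<Rightarrow> 'm \<Rightarrow> 'm \<Rightarrow> 'm"
    \<comment> \<open>\<open>Comp C X Y Z g f\<close> for \<open>f : X \<rightarrow> Y\<close> and \<open>g : Y \<rightarrow> Z\<close>\<close>
  Id :: "'o \<Rightarrow> 'm"

locale preadditive_category =
  fixes C :: "('o, 'm) precat"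
  assumes Hom_group: "\<lbrakk>X \<in> Obj C; Y \<in> Obj C\<rbrakk> \<Longrightarrow> comm_group (Hom C X Y)"
    and Id_closed: "X \<in> Obj C \<Longrightarrow> Id C X \<in> carrier (Hom C X X)"
    and Comp_hom_left: "\<lbrakk>X \<in> Obj C; Y \<in> Obj C; Z \<in> Obj C; f \<in> carrier (Hom C X Y)\<rbrakk>
      \<Longrightarrow> (\<lambda>g. Comp C X Y Z g f) \<in> hom (Hom C Y Z) (Hom C X Z)"
    and Comp_hom_right: "\<lbrakk>X \<in> Obj C; Y \<in> Obj C; Z \<in> Obj C; g \<in> carrier (Hom C Y Z)\<rbrakk>
      \<Longrightarrow> (\<lambda>f. Comp C X Y Z g f) \<in> hom (Hom C X Y) (Hom C X Z)"
    and Comp_assoc: "\<lbrakk>W \<in> Obj C; X \<in> Obj C; Y \<in> Obj C; Z \<in> Obj C; f \<in> carrier (Hom C W X);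
        g \<in> carrier (Hom C X Y); h \<in> carrier (Hom C Y Z)\<rbrakk>
      \<Longrightarrow> Comp C W X Z (Comp C X Y Z h g) f = Comp C W Y Z h (Comp C W X Y g f)"
    and Comp_Id_left: "\<lbrakk>X \<in> Obj C; Y \<in> Obj C; f \<in> carrier (Hom C X Y)\<rbrakk>
      \<Longrightarrow> Comp C X Y Y (Id C Y) f = f"
    and Comp_Id_right: "\<lbrakk>X \<in> Obj C; Y \<in> Obj C; f \<in> carrier (Hom C X Y)\<rbrakk>
      \<Longrightarrow> Comp C X X Y f (Id C X) = f"

definition zero_object :: "('o, 'm) precat \<Rightarrow> 'o \<Rightarrow> bool" where
  "zero_object C Z \<longleftrightarrow> Z \<in> Obj C \<and>
     (\<forall>X\<in>Obj C. (\<exists>!f. f \<in> carrier (Hom C X Z)) \<and> (\<exists>!f. f \<in> carrier (Hom C Z X)))"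

definition direct_sum :: "('o, 'm) precat \<Rightarrow> 'o \<Rightarrow> 'o \<Rightarrow> 'o \<Rightarrow> bool" where
  "direct_sum C X Y B \<longleftrightarrow> B \<in> Obj C \<and>
     (\<exists>i\<in>carrier (Hom C X B). \<exists>j\<in>carrier (Hom C Y B).
      \<exists>p\<in>carrier (Hom C B X). \<exists>q\<in>carrier (Hom C B Y).
        Comp C X B X p i = Id C X \<and> Comp C Y B Y q j = Id C Y \<and>
        Comp C Y B X p j = \<one>\<^bsub>Hom C Y X\<^esub> \<and> Comp C X B Y q i = \<one>\<^bsub>Hom C X Y\<^esub> \<and>
        Comp C B X B i p \<otimes>\<^bsub>Hom C B B\<^esub> Comp C B Y B j q = Id C B)"

definition additive_category :: "('o, 'm) precat \<Rightarrow> bool" where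
  "additive_category C \<longleftrightarrow> preadditive_category C \<and> (\<exists>Z. zero_object C Z) \<and>
     (\<forall>X\<in>Obj C. \<forall>Y\<in>Obj C. \<exists>B. direct_sum C X Y B)"

definition is_kernel :: "('o, 'm) precat \<Rightarrow> 'o \<Rightarrow> 'o \<Rightarrow> 'm \<Rightarrow> 'o \<Rightarrow> 'm \<Rightarrow> bool" where
  "is_kernel C X Y f K k \<longleftrightarrow> K \<in> Obj C \<and> k \<in> carrier (Hom C K X) \<and>
     Comp C K X Y f k = \<one>\<^bsub>Hom C K Y\<^esub> \<and>
     (\<forall>T\<in>Obj C. \<forall>t\<in>carrier (Hom C T X). Comp C T X Y f t = \<one>\<^bsub>Hom C T Y\<^esub> \<longrightarrow>
        (\<exists>!s. s \<in> carrier (Hom C T K) \<and> Comp C T K X k s = t))"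

definition is_cokernel :: "('o, 'm) precat \<Rightarrow> 'o \<Rightarrow> 'o \<Rightarrow> 'm \<Rightarrow> 'o \<Rightarrow> 'm \<Rightarrow> bool" where
  "is_cokernel C X Y f Q q \<longleftrightarrow> Q \<in> Obj C \<and> q \<in> carrier (Hom C Y Q) \<and>
     Comp C X Y Q q f = \<one>\<^bsub>Hom C X Q\<^esub> \<and>
     (\<forall>T\<in>Obj C. \<forall>t\<in>carrier (Hom C Y T). Comp C X Y T t f = \<one>\<^bsub>Hom C X T\<^esub> \<longrightarrow>
        (\<exists>!s. s \<in> carrier (Hom C Q T) \<and> Comp C Y Q T s q = t))"

definition is_mono :: "('o, 'm) precat \<Rightarrow> 'o \<Rightarrow> 'o \<Rightarrow> 'm \<Rightarrow> bool" where
  "is_mono C X Y f \<longleftrightarrow> (\<forall>T\<in>Obj C. \<forall>s\<in>carrier (Hom C T X). \<forall>t\<in>carrier (Hom C T X).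
     Comp C T X Y f s = Comp C T X Y f t \<longrightarrow> s = t)"

definition is_epi :: "('o, 'm) precat \<Rightarrow> 'o \<Rightarrow> 'o \<Rightarrow> 'm \<Rightarrow> bool" where
  "is_epi C X Y f \<longleftrightarrow> (\<forall>T\<in>Obj C. \<forall>s\<in>carrier (Hom C Y T). \<forall>t\<in>carrier (Hom C Y T).
     Comp C X Y T s f = Comp C X Y T t f \<longrightarrow> s = t)"

definition abelian_category :: "('o, 'm) precat \<Rightarrow> bool" where
  "abelian_category C \<longleftrightarrow> additive_category C \<and>
     (\<forall>X\<in>Obj C. \<forall>Y\<in>Obj C. \<forall>f\<in>carrier (Hom C X Y).
        (\<exists>K k. is_kernel C X Y f K k) \<and>
        (\<exists>Q q. is_cokernel C X Y f Q q) \<and>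
        (is_mono C X Y f \<longrightarrow>
           (\<exists>Z\<in>Obj C. \<exists>g\<in>carrier (Hom C Y Z). is_kernel C Y Z g X f)) \<and>
        (is_epi C X Y f \<longrightarrow>
           (\<exists>W\<in>Obj C. \<exists>g\<in>carrier (Hom C W X). is_cokernel C W X g Y f)))"

definition idempotents_split :: "('o, 'm) precat \<Rightarrow> bool" where
  "idempotents_split C \<longleftrightarrow> (\<forall>X\<in>Obj C. \<forall>e\<in>carrier (Hom C X X). Comp C X X X e e = e \<longrightarrow>
     (\<exists>Y\<in>Obj C. \<exists>p\<in>carrier (Hom C X Y). \<exists>i\<in>carrier (Hom C Y X).
        Comp C X Y X i p = e \<and> Comp C Y X Y p i = Id C Y))"

section \<open>DG-categories\<close>

text \<open>The grading group is the type \<open>'g\<close>; \<open>u\<close> is the distinguished element of degree one.\<close>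

locale grading =
  fixes \<sigma> :: "'g::ab_group_add \<Rightarrow> 'g \<Rightarrow> bit" and u :: 'g
  assumes \<sigma>_add: "\<sigma> (i + j) k = \<sigma> i k + \<sigma> j k"
    and \<sigma>_sym: "\<sigma> i j = \<sigma> j i"
    and \<sigma>_u: "\<sigma> u u = 1"

definition signed :: "('g::ab_group_add \<Rightarrow> 'g \<Rightarrow> bit) \<Rightarrow> 'g \<Rightarrow> 'm monoid \<Rightarrow> 'g \<Rightarrow> 'm \<Rightarrow> 'm" where
  "signed \<sigma> u G i f = (if \<sigma> u i = 0 then f else inv\<^bsub>G\<^esub> f)"
  \<comment> \<open>\<open>(-1)\<^sup>i f\<close> in the Hom group \<open>G\<close>, where \<open>(-1)\<^sup>i\<close> stands for \<open>(-1)\<close> to the power \<open>\<sigma> u i\<close>\<close>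

record ('g, 'o, 'm) dgcat =
  DObj :: "'o set"
  DHom :: "'o \<Rightarrow> 'o \<Rightarrow> 'g \<Rightarrow> 'm monoid"
  DDif :: "'o \<Rightarrow> 'o \<Rightarrow> 'g \<Rightarrow> 'm \<Rightarrow> 'm"
  DComp :: "'o \<Rightarrow> 'o \<Rightarrow> 'o \<Rightarrow> 'g \<Rightarrow> 'g \<Rightarrow> 'm \<Rightarrow> 'm \<Rightarrow> 'm"
    \<comment> \<open>\<open>DComp A X Y Z i j g f\<close> for \<open>f : X \<rightarrow> Y\<close> of degree \<open>j\<close> and \<open>g : Y \<rightarrow> Z\<close> of degree \<open>i\<close>\<close>
  DId :: "'o \<Rightarrow> 'm"

locale dg_category = grading \<sigma> u
  for \<sigma> :: "'g::ab_group_add \<Rightarrow> 'g \<Rightarrow> bit" and u :: 'g +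
  fixes A :: "('g, 'o, 'm) dgcat"
  assumes DHom_group: "\<lbrakk>X \<in> DObj A; Y \<in> DObj A\<rbrakk> \<Longrightarrow> comm_group (DHom A X Y i)"
    and DDif_hom: "\<lbrakk>X \<in> DObj A; Y \<in> DObj A\<rbrakk>
      \<Longrightarrow> DDif A X Y i \<in> hom (DHom A X Y i) (DHom A X Y (i + u))"
    and DDif_DDif: "\<lbrakk>X \<in> DObj A; Y \<in> DObj A; f \<in> carrier (DHom A X Y i)\<rbrakk>
      \<Longrightarrow> DDif A X Y (i + u) (DDif A X Y i f) = \<one>\<^bsub>DHom A X Y (i + u + u)\<^esub>"
    and DComp_hom_left: "\<lbrakk>X \<in> DObj A; Y \<in> DObj A; Z \<in> DObj A; f \<in> carrier (DHom A X Y j)\<rbrakk>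
      \<Longrightarrow> (\<lambda>g. DComp A X Y Z i j g f) \<in> hom (DHom A Y Z i) (DHom A X Z (i + j))"
    and DComp_hom_right: "\<lbrakk>X \<in> DObj A; Y \<in> DObj A; Z \<in> DObj A; g \<in> carrier (DHom A Y Z i)\<rbrakk>
      \<Longrightarrow> (\<lambda>f. DComp A X Y Z i j g f) \<in> hom (DHom A X Y j) (DHom A X Z (i + j))"
    and DComp_assoc: "\<lbrakk>W \<in> DObj A; X \<in> DObj A; Y \<in> DObj A; Z \<in> DObj A;
        f \<in> carrier (DHom A W X k); g \<in> carrier (DHom A X Y j); h \<in> carrier (DHom A Y Z i)\<rbrakk>
      \<Longrightarrow> DComp A W X Z (i + j) k (DComp A X Y Z i j h g) f
        = DComp A W Y Z i (j + k) h (DComp A W X Y j k g f)"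
    and DId_closed: "X \<in> DObj A \<Longrightarrow> DId A X \<in> carrier (DHom A X X 0)"
    and DDif_DId: "X \<in> DObj A \<Longrightarrow> DDif A X X 0 (DId A X) = \<one>\<^bsub>DHom A X X u\<^esub>"
    and DComp_DId_left: "\<lbrakk>X \<in> DObj A; Y \<in> DObj A; f \<in> carrier (DHom A X Y i)\<rbrakk>
      \<Longrightarrow> DComp A X Y Y 0 i (DId A Y) f = f"
    and DComp_DId_right: "\<lbrakk>X \<in> DObj A; Y \<in> DObj A; f \<in> carrier (DHom A X Y i)\<rbrakk>
      \<Longrightarrow> DComp A X X Y i 0 f (DId A X) = f"
    and Leibniz: "\<lbrakk>X \<in> DObj A; Y \<in> DObj A; Z \<in> DObj A;
        f \<in> carrier (DHom A X Y j); g \<in> carrier (DHom A Y Z i)\<rbrakk>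
      \<Longrightarrow> DDif A X Z (i + j) (DComp A X Y Z i j g f) =
          DComp A X Y Z (i + u) j (DDif A Y Z i g) f \<otimes>\<^bsub>DHom A X Z (i + j + u)\<^esub>
          signed \<sigma> u (DHom A X Z (i + j + u)) i (DComp A X Y Z i (j + u) g (DDif A X Y j f))"

definition closed_hom :: "('g::ab_group_add) \<Rightarrow> ('g, 'o, 'm) dgcat \<Rightarrow> 'o \<Rightarrow> 'o \<Rightarrow> 'g \<Rightarrow> 'm monoid" where
  "closed_hom u A X Y i = (DHom A X Y i)
     \<lparr>carrier := {f \<in> carrier (DHom A X Y i). DDif A X Y i f = \<one>\<^bsub>DHom A X Y (i + u)\<^esub>}\<rparr>"

definition Z0 :: "('g::ab_group_add) \<Rightarrow> ('g, 'o, 'm) dgcat \<Rightarrow> ('o, 'm) precat" where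
  "Z0 u A = \<lparr>Obj = DObj A, Hom = (\<lambda>X Y. closed_hom u A X Y 0),
     Comp = (\<lambda>X Y Z. DComp A X Y Z 0 0), Id = DId A\<rparr>"

text \<open>
  The DG-category \<open>A\<^sup>\<natural>\<close>.  A degree \<open>i\<close> morphism is a closed morphism of \<open>A\<close> of degree \<open>-i\<close>, and
  \<open>d\<^sup>\<natural> f = t f - (-1)\<^sup>i f s\<close> for \<open>f : (X, s) \<rightarrow> (Y, t)\<close>; composition and identities are those of \<open>A\<close>.
\<close>

definition natural ::
  "('g::ab_group_add \<Rightarrow> 'g \<Rightarrow> bit) \<Rightarrow> 'g \<Rightarrow> ('g, 'o, 'm) dgcat \<Rightarrow> ('g, 'o \<times> 'm, 'm) dgcat" where
  "natural \<sigma> u A = \<lparr>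
     DObj = {(X, s). X \<in> DObj A \<and> s \<in> carrier (DHom A X X (- u)) \<and>
       DDif A X X (- u) s = DId A X \<and>
       DComp A X X X (- u) (- u) s s = \<one>\<^bsub>DHom A X X (- u + - u)\<^esub>},
     DHom = (\<lambda>(X, s) (Y, t) i. closed_hom u A X Y (- i)),
     DDif = (\<lambda>(X, s) (Y, t) i f.
       DComp A X Y Y (- u) (- i) t f \<otimes>\<^bsub>DHom A X Y (- (i + u))\<^esub>
       inv\<^bsub>DHom A X Y (- (i + u))\<^esub>
         signed \<sigma> u (DHom A X Y (- (i + u))) i (DComp A X X Y (- i) (- u) f s)),
     DComp = (\<lambda>(X, s) (Y, t) (Z, r) i j. DComp A X Y Z (- i) (- j)),
     DId = (\<lambda>(X, s). DId A X)\<rparr>"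

definition is_shift :: "('g::ab_group_add) \<Rightarrow> ('g, 'o, 'm) dgcat \<Rightarrow> 'o \<Rightarrow> 'g \<Rightarrow> 'o \<Rightarrow> bool" where
  "is_shift u A X i Y \<longleftrightarrow> Y \<in> DObj A \<and>
     (\<exists>f\<in>carrier (closed_hom u A X Y (- i)). \<exists>g\<in>carrier (closed_hom u A Y X i).
        DComp A X Y X i (- i) g f = DId A X \<and> DComp A Y X Y (- i) i f g = DId A Y)"

text \<open>
  The cone of a morphism of complexes \<open>\<phi> : K \<rightarrow> L\<close> has the components \<open>L\<^sup>n \<oplus> K\<^sup>n\<^sup>+\<^sup>1\<close> and the
  differential \<open>(l, k) \<mapsto> (d l + \<phi> k, - d k)\<close>.  Here \<open>K = Hom(Z, X)\<close>, \<open>L = Hom(Z, Y)\<close> and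
  \<open>\<phi>\<close> is composition with \<open>f\<close>.  A morphism \<open>h : Z' \<rightarrow> Z\<close> of any degree acts on the complex by
  \<open>(l, k) \<mapsto> (l h, k h)\<close>; with this sign convention the right action satisfies the Leibniz rule,
  so naturality below is naturality of DG-functors and not just on closed \<open>h\<close> of degree \<open>0\<close>.
\<close>

definition cone_group ::
  "('g::ab_group_add) \<Rightarrow> ('g, 'o, 'm) dgcat \<Rightarrow> 'o \<Rightarrow> 'o \<Rightarrow> 'o \<Rightarrow> 'g \<Rightarrow> ('m \<times> 'm) monoid" where
  "cone_group u A X Y Z n = DHom A Z Y n \<times>\<times> DHom A Z X (n + u)"

definition cone_dif ::
  "('g::ab_group_add) \<Rightarrow> ('g, 'o, 'm) dgcat \<Rightarrow> 'o \<Rightarrow> 'o \<Rightarrow> 'm \<Rightarrow> 'o \<Rightarrow> 'g \<Rightarrow> 'm \<times> 'm \<Rightarrow> 'm \<times> 'm" where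
  "cone_dif u A X Y f Z n = (\<lambda>(l, k).
     (DDif A Z Y n l \<otimes>\<^bsub>DHom A Z Y (n + u)\<^esub> DComp A Z X Y 0 (n + u) f k,
      inv\<^bsub>DHom A Z X (n + u + u)\<^esub> DDif A Z X (n + u) k))"

definition is_cone :: "('g::ab_group_add) \<Rightarrow> ('g, 'o, 'm) dgcat \<Rightarrow> 'o \<Rightarrow> 'o \<Rightarrow> 'm \<Rightarrow> 'o \<Rightarrow> bool" where
  "is_cone u A X Y f C \<longleftrightarrow> C \<in> DObj A \<and> (\<exists>\<Theta>.
     (\<forall>Z\<in>DObj A. \<forall>n. \<Theta> Z n \<in> iso (DHom A Z C n) (cone_group u A X Y Z n)) \<and>
     (\<forall>Z\<in>DObj A. \<forall>n. \<forall>x\<in>carrier (DHom A Z C n).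
        \<Theta> Z (n + u) (DDif A Z C n x) = cone_dif u A X Y f Z n (\<Theta> Z n x)) \<and>
     (\<forall>Z\<in>DObj A. \<forall>Z'\<in>DObj A. \<forall>n j.
        \<forall>x\<in>carrier (DHom A Z C n). \<forall>h\<in>carrier (DHom A Z' Z j).
        \<Theta> Z' (n + j) (DComp A Z' Z C n j x h) =
          (DComp A Z' Z Y n j (fst (\<Theta> Z n x)) h,
           DComp A Z' Z X (n + u) j (snd (\<Theta> Z n x)) h)))"

definition twisting_element :: "('g::ab_group_add) \<Rightarrow> ('g, 'o, 'm) dgcat \<Rightarrow> 'o \<Rightarrow> 'm \<Rightarrow> bool" where
  "twisting_element u A X a \<longleftrightarrow> a \<in> carrier (DHom A X X u) \<and>
     DDif A X X u a \<otimes>\<^bsub>DHom A X X (u + u)\<^esub> DComp A X X X u u a a = \<one>\<^bsub>DHom A X X (u + u)\<^esub>"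

definition is_twist :: "('g::ab_group_add) \<Rightarrow> ('g, 'o, 'm) dgcat \<Rightarrow> 'o \<Rightarrow> 'm \<Rightarrow> 'o \<Rightarrow> bool" where
  "is_twist u A X a Y \<longleftrightarrow> Y \<in> DObj A \<and>
     (\<exists>f\<in>carrier (DHom A X Y 0). \<exists>g\<in>carrier (DHom A Y X 0).
        DComp A X Y X 0 0 g f = DId A X \<and> DComp A Y X Y 0 0 f g = DId A Y \<and>
        DDif A X Y 0 f = DComp A X X Y 0 u f a)"

definition has_shifts :: "('g::ab_group_add) \<Rightarrow> ('g, 'o, 'm) dgcat \<Rightarrow> bool" where
  "has_shifts u A \<longleftrightarrow> (\<forall>X\<in>DObj A. \<forall>i. \<exists>Y. is_shift u A X i Y)"

definition has_cones :: "('g::ab_group_add) \<Rightarrow> ('g, 'o, 'm) dgcat \<Rightarrow> bool" where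
  "has_cones u A \<longleftrightarrow> (\<forall>X\<in>DObj A. \<forall>Y\<in>DObj A. \<forall>f\<in>carrier (closed_hom u A X Y 0).
     \<exists>C. is_cone u A X Y f C)"

definition has_twists :: "('g::ab_group_add) \<Rightarrow> ('g, 'o, 'm) dgcat \<Rightarrow> bool" where
  "has_twists u A \<longleftrightarrow> (\<forall>X\<in>DObj A. \<forall>a. twisting_element u A X a \<longrightarrow> (\<exists>Y. is_twist u A X a Y))"

definition dg_additive :: "('g::ab_group_add) \<Rightarrow> ('g, 'o, 'm) dgcat \<Rightarrow> bool" where
  "dg_additive u A \<longleftrightarrow> additive_category (Z0 u A)"

definition dg_idempotent_complete :: "('g::ab_group_add) \<Rightarrow> ('g, 'o, 'm) dgcat \<Rightarrow> bool" where
  "dg_idempotent_complete u A \<longleftrightarrow> idempotents_split (Z0 u A)"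

definition abelian_dg_category ::
  "('g::ab_group_add \<Rightarrow> 'g \<Rightarrow> bit) \<Rightarrow> 'g \<Rightarrow> ('g, 'o, 'm) dgcat \<Rightarrow> bool" where
  "abelian_dg_category \<sigma> u A \<longleftrightarrow> dg_category \<sigma> u A \<and> dg_additive u A \<and>
     has_shifts u A \<and> has_cones u A \<and>
     abelian_category (Z0 u A) \<and> abelian_category (Z0 u (natural \<sigma> u A))"

end

theory Submission
  imports Defs
begin

text \<open>
  Idempotents: a kernel of \<open>1 - e\<close> in the category of closed morphisms is an image of \<open>e\<close>.

  Twists: \<open>X(a)\<close> is characterized by the closed morphisms of degree zero out of it.  If
  \<open>f : X \<rightarrow> X(a)\<close> denotes the structure morphism, then composition with \<open>f\<close> identifies the closed
  morphisms \<open>X(a) \<rightarrow> W\<close> with the degree zero elements \<open>t : X \<rightarrow> W\<close> satisfying \<open>d t = t a\<close>.  An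
  object with this universal property exists as a cokernel.  The cones of identity morphisms
  and the shifts provide an object \<open>G\<close> with an element \<open>\<iota> : X \<rightarrow> G\<close> which is free of degree zero:
  every degree zero element \<open>X \<rightarrow> W\<close>, closed or not, is \<open>b \<iota>\<close> for a unique closed
  \<open>b : G \<rightarrow> W\<close> (\<open>exists_free\<close>).  In the quotient of \<open>G\<close> by the relation
  \<open>d \<iota> = \<iota> a\<close>, the image of \<open>\<iota>\<close> is the required \<open>f : X \<rightarrow> Y\<close> (\<open>twist_classifier\<close>).

  The universal property speaks of closed morphisms out of \<open>Y\<close> only, whereas a twist needs an
  inverse \<open>g\<close> of \<open>f\<close>, which is not closed unless \<open>a = 0\<close>.  The link is that the cone \<open>C\<close> of the
  identity of \<open>W\<close> with its projection \<open>p : C \<rightarrow> W\<close> is cofree: arbitrary degree zero elements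
  \<open>V \<rightarrow> W\<close> lift along \<open>p\<close> to closed morphisms \<open>V \<rightarrow> C\<close>.  For \<open>W = X\<close>, the identity of \<open>X\<close> lifts
  along \<open>p\<close> to an element \<open>t\<close> with \<open>d t = t a\<close> (\<open>twisted_section\<close>), which factors through \<open>f\<close>
  and so yields \<open>g\<close> with \<open>g f = 1\<close>.  Then \<open>f g = 1\<close> holds because two degree zero elements
  \<open>Y \<rightarrow> W\<close> with the same restriction along \<open>f\<close> lift to closed morphisms \<open>Y \<rightarrow> C\<close> with the same
  restriction along \<open>f\<close> (\<open>has_twists_if_cokernels\<close>).
\<close>

section \<open>Idempotents\<close>

text \<open>
  A morphism \<open>t\<close> is killed by \<open>1 - e\<close> exactly when \<open>e t = t\<close>.  In particular \<open>e\<close> factors through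
  the kernel \<open>k\<close> as \<open>k p\<close>, and \<open>k p k = e k = k\<close> forces \<open>p k = 1\<close>, as \<open>k\<close> is a monomorphism.
\<close>

lemma (in preadditive_category) idempotent_splits_if_kernel:
  assumes X: "X \<in> Obj C" and e: "e \<in> carrier (Hom C X X)" and idem: "Comp C X X X e e = e"
    and ker: "is_kernel C X X (Id C X \<otimes>\<^bsub>Hom C X X\<^esub> inv\<^bsub>Hom C X X\<^esub> e) K k"
  shows "\<exists>p\<in>carrier (Hom C X K). Comp C X K X k p = e \<and> Comp C K X K p k = Id C K"
proof -
  let ?f = "Id C X \<otimes>\<^bsub>Hom C X X\<^esub> inv\<^bsub>Hom C X X\<^esub> e"
  have K: "K \<in> Obj C" and k: "k \<in> carrier (Hom C K X)" and fk: "Comp C K X X ?f k = \<one>\<^bsub>Hom C K X\<^esub>"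
    and univ: "\<And>T t. \<lbrakk>T \<in> Obj C; t \<in> carrier (Hom C T X); Comp C T X X ?f t = \<one>\<^bsub>Hom C T X\<^esub>\<rbrakk>
      \<Longrightarrow> \<exists>!s. s \<in> carrier (Hom C T K) \<and> Comp C T K X k s = t"
    using ker unfolding is_kernel_def by blast+
  have compl: "Comp C T X X ?f t = t \<otimes>\<^bsub>Hom C T X\<^esub> inv\<^bsub>Hom C T X\<^esub> Comp C T X X e t"
    and et: "Comp C T X X e t \<in> carrier (Hom C T X)"
    if T: "T \<in> Obj C" and t: "t \<in> carrier (Hom C T X)" for T t
  proof -
    interpret XX: comm_group "Hom C X X" by (rule Hom_group[OF X X])
    interpret TX: comm_group "Hom C T X" by (rule Hom_group[OF T X])
    interpret c: group_hom "Hom C X X" "Hom C T X" "\<lambda>g. Comp C T X X g t"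
      by unfold_locales (rule Comp_hom_left[OF T X X t])
    show "Comp C T X X ?f t = t \<otimes>\<^bsub>Hom C T X\<^esub> inv\<^bsub>Hom C T X\<^esub> Comp C T X X e t"
      using e Id_closed[OF X] by (simp add: Comp_Id_left[OF T X t])
    show "Comp C T X X e t \<in> carrier (Hom C T X)"
      using e by simp
  qed
  have ek: "Comp C K X X e k = k"
  proof -
    interpret KX: comm_group "Hom C K X" by (rule Hom_group[OF K X])
    show ?thesis using compl[OF K k] et[OF K k] fk k
      by (metis KX.inv_closed KX.inv_equality KX.inv_inv)
  qed
  have "Comp C X X X ?f e = \<one>\<^bsub>Hom C X X\<^esub>"
  proof -
    interpret XX: comm_group "Hom C X X" by (rule Hom_group[OF X X])
    show ?thesis using compl[OF X e] e by (simp add: idem)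
  qed
  then obtain p where p: "p \<in> carrier (Hom C X K)" and kp: "Comp C X K X k p = e"
    using univ[OF X e] by blast
  have pk: "Comp C K X K p k \<in> carrier (Hom C K K)"
    using Comp_hom_right[OF K X K p] k by (auto simp: hom_def Pi_def)
  have "Comp C K K X k (Comp C K X K p k) = k"
    using Comp_assoc[OF K X K X k p k] kp ek by simp
  moreover have "Comp C K K X k (Id C K) = k"
    by (rule Comp_Id_right[OF K X k])
  ultimately have "Comp C K X K p k = Id C K"
    using univ[OF K k fk] pk Id_closed[OF K] by blast
  then show ?thesis using p kp by blast
qed

lemma abelian_category_idempotents_split:
  assumes "abelian_category C"
  shows "idempotents_split C"
proof -
  interpret preadditive_category C
    using assms unfolding abelian_category_def additive_category_def by blast
  show ?thesis unfolding idempotents_split_def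
  proof (intro ballI impI)
    fix X e assume X: "X \<in> Obj C" and e: "e \<in> carrier (Hom C X X)" and idem: "Comp C X X X e e = e"
    let ?f = "Id C X \<otimes>\<^bsub>Hom C X X\<^esub> inv\<^bsub>Hom C X X\<^esub> e"
    interpret XX: comm_group "Hom C X X" by (rule Hom_group[OF X X])
    have "?f \<in> carrier (Hom C X X)" using e Id_closed[OF X] by simp
    then obtain K k where k: "is_kernel C X X ?f K k"
      using assms X unfolding abelian_category_def by blast
    then have "K \<in> Obj C" "k \<in> carrier (Hom C K X)" unfolding is_kernel_def by blast+
    with idempotent_splits_if_kernel[OF X e idem k]
    show "\<exists>Y\<in>Obj C. \<exists>p\<in>carrier (Hom C X Y). \<exists>i\<in>carrier (Hom C Y X).
        Comp C X Y X i p = e \<and> Comp C Y X Y p i = Id C Y" by blast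
  qed
qed

section \<open>Arithmetic in a DG-category\<close>

context grading
begin

lemma \<sigma>_u_0 [simp]: "\<sigma> u 0 = 0"
  using \<sigma>_add[of 0 0 u] \<sigma>_sym[of 0 u] by simp

lemma \<sigma>_u_minus_u [simp]: "\<sigma> u (- u) = 1"
proof -
  have "\<sigma> u u + \<sigma> u (- u) = 0"
    using \<sigma>_add[of u "- u" u] \<sigma>_add[of 0 0 u] \<sigma>_sym[of "- u" u] by simp
  then show ?thesis
    by (cases "\<sigma> u (- u)") (simp_all add: \<sigma>_u)
qed

end

context dg_category
begin

abbreviation H :: "'o \<Rightarrow> 'o \<Rightarrow> 'g \<Rightarrow> 'm set" where
  "H X Y i \<equiv> carrier (DHom A X Y i)"

abbreviation Z :: "'o \<Rightarrow> 'o \<Rightarrow> 'm set" where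
  "Z X Y \<equiv> carrier (closed_hom u A X Y 0)"

lemma Z_iff: "f \<in> Z X Y \<longleftrightarrow> f \<in> H X Y 0 \<and> DDif A X Y 0 f = \<one>\<^bsub>DHom A X Y u\<^esub>"
  by (simp add: closed_hom_def)

lemma comp_closed:
  "\<lbrakk>X \<in> DObj A; Y \<in> DObj A; W \<in> DObj A; g \<in> H Y W i; f \<in> H X Y j; k = i + j\<rbrakk>
    \<Longrightarrow> DComp A X Y W i j g f \<in> H X W k"
  using DComp_hom_left[of X Y W f j i] by (auto simp: hom_def Pi_def)

lemma dif_closed:
  "\<lbrakk>X \<in> DObj A; Y \<in> DObj A; f \<in> H X Y i; k = i + u\<rbrakk> \<Longrightarrow> DDif A X Y i f \<in> H X Y k"
  using DDif_hom[of X Y i] by (auto simp: hom_def Pi_def)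

lemma comp_add_left:
  "\<lbrakk>X \<in> DObj A; Y \<in> DObj A; W \<in> DObj A; g \<in> H Y W i; g' \<in> H Y W i; f \<in> H X Y j; k = i + j\<rbrakk>
    \<Longrightarrow> DComp A X Y W i j (g \<otimes>\<^bsub>DHom A Y W i\<^esub> g') f =
      DComp A X Y W i j g f \<otimes>\<^bsub>DHom A X W k\<^esub> DComp A X Y W i j g' f"
  using DComp_hom_left[of X Y W f j i] by (auto simp: hom_def)

lemma comp_add_right:
  "\<lbrakk>X \<in> DObj A; Y \<in> DObj A; W \<in> DObj A; g \<in> H Y W i; f \<in> H X Y j; f' \<in> H X Y j; k = i + j\<rbrakk>
    \<Longrightarrow> DComp A X Y W i j g (f \<otimes>\<^bsub>DHom A X Y j\<^esub> f') =
      DComp A X Y W i j g f \<otimes>\<^bsub>DHom A X W k\<^esub> DComp A X Y W i j g f'"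
  using DComp_hom_right[of X Y W g i j] by (auto simp: hom_def)

lemma dif_add:
  "\<lbrakk>X \<in> DObj A; Y \<in> DObj A; f \<in> H X Y i; f' \<in> H X Y i; k = i + u\<rbrakk>
    \<Longrightarrow> DDif A X Y i (f \<otimes>\<^bsub>DHom A X Y i\<^esub> f') =
      DDif A X Y i f \<otimes>\<^bsub>DHom A X Y k\<^esub> DDif A X Y i f'"
  using DDif_hom[of X Y i] by (auto simp: hom_def)

lemma comp_group_hom_left:
  "\<lbrakk>X \<in> DObj A; Y \<in> DObj A; W \<in> DObj A; f \<in> H X Y j\<rbrakk>
    \<Longrightarrow> group_hom (DHom A Y W i) (DHom A X W (i + j)) (\<lambda>g. DComp A X Y W i j g f)"
  by (simp add: group_hom_def group_hom_axioms_def comm_group.axioms(2) DHom_group DComp_hom_left)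

lemma comp_group_hom_right:
  "\<lbrakk>X \<in> DObj A; Y \<in> DObj A; W \<in> DObj A; g \<in> H Y W i\<rbrakk>
    \<Longrightarrow> group_hom (DHom A X Y j) (DHom A X W (i + j)) (\<lambda>f. DComp A X Y W i j g f)"
  by (simp add: group_hom_def group_hom_axioms_def comm_group.axioms(2) DHom_group DComp_hom_right)

lemma dif_group_hom:
  "\<lbrakk>X \<in> DObj A; Y \<in> DObj A\<rbrakk> \<Longrightarrow> group_hom (DHom A X Y i) (DHom A X Y (i + u)) (DDif A X Y i)"
  by (simp add: group_hom_def group_hom_axioms_def comm_group.axioms(2) DHom_group DDif_hom)

lemma comp_zero_left:
  "\<lbrakk>X \<in> DObj A; Y \<in> DObj A; W \<in> DObj A; f \<in> H X Y j; k = i + j\<rbrakk>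
    \<Longrightarrow> DComp A X Y W i j \<one>\<^bsub>DHom A Y W i\<^esub> f = \<one>\<^bsub>DHom A X W k\<^esub>"
  using group_hom.hom_one[OF comp_group_hom_left] by simp

lemma comp_zero_right:
  "\<lbrakk>X \<in> DObj A; Y \<in> DObj A; W \<in> DObj A; g \<in> H Y W i; k = i + j\<rbrakk>
    \<Longrightarrow> DComp A X Y W i j g \<one>\<^bsub>DHom A X Y j\<^esub> = \<one>\<^bsub>DHom A X W k\<^esub>"
  using group_hom.hom_one[OF comp_group_hom_right] by simp

lemma comp_neg_left:
  "\<lbrakk>X \<in> DObj A; Y \<in> DObj A; W \<in> DObj A; g \<in> H Y W i; f \<in> H X Y j; k = i + j\<rbrakk>
    \<Longrightarrow> DComp A X Y W i j (inv\<^bsub>DHom A Y W i\<^esub> g) f = inv\<^bsub>DHom A X W k\<^esub> DComp A X Y W i j g f"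
  using group_hom.hom_inv[OF comp_group_hom_left] by simp

lemma comp_neg_right:
  "\<lbrakk>X \<in> DObj A; Y \<in> DObj A; W \<in> DObj A; g \<in> H Y W i; f \<in> H X Y j; k = i + j\<rbrakk>
    \<Longrightarrow> DComp A X Y W i j g (inv\<^bsub>DHom A X Y j\<^esub> f) = inv\<^bsub>DHom A X W k\<^esub> DComp A X Y W i j g f"
  using group_hom.hom_inv[OF comp_group_hom_right] by simp

lemma dif_neg:
  "\<lbrakk>X \<in> DObj A; Y \<in> DObj A; f \<in> H X Y i; k = i + u\<rbrakk>
    \<Longrightarrow> DDif A X Y i (inv\<^bsub>DHom A X Y i\<^esub> f) = inv\<^bsub>DHom A X Y k\<^esub> DDif A X Y i f"
  using group_hom.hom_inv[OF dif_group_hom] by simp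

lemma dif_zero:
  "\<lbrakk>X \<in> DObj A; Y \<in> DObj A; k = i + u\<rbrakk>
    \<Longrightarrow> DDif A X Y i \<one>\<^bsub>DHom A X Y i\<^esub> = \<one>\<^bsub>DHom A X Y k\<^esub>"
  using group_hom.hom_one[OF dif_group_hom] by simp

lemma dif_dif:
  "\<lbrakk>X \<in> DObj A; Y \<in> DObj A; f \<in> H X Y i; k = i + u\<rbrakk>
    \<Longrightarrow> DDif A X Y k (DDif A X Y i f) = \<one>\<^bsub>DHom A X Y (k + u)\<^esub>"
  using DDif_DDif by simp

lemma Leibniz_0:
  assumes "X \<in> DObj A" "Y \<in> DObj A" "W \<in> DObj A" "g \<in> H Y W 0" "f \<in> H X Y j"
  shows "DDif A X W j (DComp A X Y W 0 j g f) =
    DComp A X Y W u j (DDif A Y W 0 g) f \<otimes>\<^bsub>DHom A X W (j + u)\<^esub>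
    DComp A X Y W 0 (j + u) g (DDif A X Y j f)"
  using Leibniz[OF assms(1-3,5,4)] by (simp add: signed_def)

lemma Leibniz_minus_u:
  assumes "X \<in> DObj A" "Y \<in> DObj A" "W \<in> DObj A" "g \<in> H Y W (- u)" "f \<in> H X Y j"
  shows "DDif A X W (j - u) (DComp A X Y W (- u) j g f) =
    DComp A X Y W 0 j (DDif A Y W (- u) g) f \<otimes>\<^bsub>DHom A X W j\<^esub>
    inv\<^bsub>DHom A X W j\<^esub> DComp A X Y W (- u) (j + u) g (DDif A X Y j f)"
  using Leibniz[OF assms(1-3,5,4)] by (simp add: signed_def)

lemma Leibniz_closed_left:
  assumes "X \<in> DObj A" "Y \<in> DObj A" "W \<in> DObj A" "g \<in> Z Y W" "f \<in> H X Y j"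
  shows "DDif A X W j (DComp A X Y W 0 j g f) = DComp A X Y W 0 (j + u) g (DDif A X Y j f)"
proof -
  interpret comm_group "DHom A X W (j + u)" using assms by (intro DHom_group)
  show ?thesis using assms Leibniz_0[of X Y W g f j]
    by (simp add: Z_iff comp_zero_left[where k = "j + u"] comp_closed dif_closed add.commute)
qed

lemma Leibniz_closed_right:
  assumes "X \<in> DObj A" "Y \<in> DObj A" "W \<in> DObj A" "g \<in> H Y W i" "f \<in> H X Y j"
    "DDif A X Y j f = \<one>\<^bsub>DHom A X Y (j + u)\<^esub>"
  shows "DDif A X W (i + j) (DComp A X Y W i j g f) = DComp A X Y W (i + u) j (DDif A Y W i g) f"
proof -
  interpret comm_group "DHom A X W (i + (j + u))" using assms by (intro DHom_group)
  have "DComp A X Y W (i + u) j (DDif A Y W i g) f \<in> H X W (i + (j + u))"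
    using assms by (auto intro!: comp_closed dif_closed simp: ac_simps)
  then show ?thesis using assms Leibniz[of X Y W f j g i]
    by (simp add: signed_def comp_zero_right[where k = "i + (j + u)"] add.assoc)
qed

lemma Z_comp:
  assumes "X \<in> DObj A" "Y \<in> DObj A" "W \<in> DObj A" "g \<in> Z Y W" "f \<in> Z X Y"
  shows "DComp A X Y W 0 0 g f \<in> Z X W"
  using assms Leibniz_closed_left[of X Y W g f 0]
  by (simp add: Z_iff comp_closed comp_zero_right)

end

section \<open>The cone of an identity morphism\<close>

text \<open>
  The representing property of the cone \<open>C\<close> of the identity of \<open>X\<close> is replaced by equations
  between finitely many morphisms.  As a graded object, \<open>C\<close> is the direct sum of \<open>X\<close> and a shift
  of \<open>X\<close>, with injections \<open>i\<close>, \<open>j\<close> and projections \<open>p\<close>, \<open>q\<close>; the differential of \<open>C\<close> appears as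
  \<open>d j = i\<close> and \<open>d p = - q\<close>.
\<close>

locale identity_cone = dg_category \<sigma> u A
  for \<sigma> :: "'g::ab_group_add \<Rightarrow> 'g \<Rightarrow> bit" and u :: 'g and A :: "('g, 'o, 'm) dgcat" +
  fixes X C :: 'o and p q i j :: 'm
  assumes X: "X \<in> DObj A" and C: "C \<in> DObj A"
    and p: "p \<in> H C X 0" and q: "q \<in> H C X u" and i: "i \<in> H X C 0" and j: "j \<in> H X C (- u)"
    and dif_p: "DDif A C X 0 p \<otimes>\<^bsub>DHom A C X u\<^esub> q = \<one>\<^bsub>DHom A C X u\<^esub>"
    and dif_q: "DDif A C X u q = \<one>\<^bsub>DHom A C X (u + u)\<^esub>"
    and dif_i: "DDif A X C 0 i = \<one>\<^bsub>DHom A X C u\<^esub>"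
    and dif_j: "DDif A X C (- u) j = i"
    and p_i: "DComp A X C X 0 0 p i = DId A X"
    and p_j: "DComp A X C X 0 (- u) p j = \<one>\<^bsub>DHom A X X (- u)\<^esub>"
    and q_j: "DComp A X C X u (- u) q j = DId A X"
    and decomposition: "DComp A C X C 0 0 i p \<otimes>\<^bsub>DHom A C C 0\<^esub> DComp A C X C (- u) u j q = DId A C"

text \<open>
  By the Yoneda lemma: the element of the cone complex that corresponds to the identity of \<open>C\<close> is
  the pair \<open>(p, q)\<close>, while \<open>i\<close> and \<open>j\<close> correspond to \<open>(1, 0)\<close> and \<open>(0, 1)\<close> over \<open>X\<close>.  The
  equations between these morphisms are read off from their pairs.
\<close>

lemma (in dg_category) identity_cone_if_is_cone:
  assumes X: "X \<in> DObj A" and cone: "is_cone u A X X (DId A X) C"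
  shows "\<exists>p q i j. identity_cone \<sigma> u A X C p q i j"
proof -
  from cone have C: "C \<in> DObj A" unfolding is_cone_def by blast
  from cone obtain \<Theta> where
    iso: "\<forall>W\<in>DObj A. \<forall>n. \<Theta> W n \<in> iso (DHom A W C n) (cone_group u A X X W n)" and
    dif: "\<forall>W\<in>DObj A. \<forall>n. \<forall>x\<in>H W C n.
      \<Theta> W (n + u) (DDif A W C n x) = cone_dif u A X X (DId A X) W n (\<Theta> W n x)" and
    nat: "\<forall>W\<in>DObj A. \<forall>W'\<in>DObj A. \<forall>n m. \<forall>x\<in>H W C n. \<forall>h\<in>H W' W m.
      \<Theta> W' (n + m) (DComp A W' W C n m x h) =
        (DComp A W' W X n m (fst (\<Theta> W n x)) h, DComp A W' W X (n + u) m (snd (\<Theta> W n x)) h)"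
    unfolding is_cone_def by (elim conjE exE) (rule that)
  note iso = iso[rule_format] and dif = dif[rule_format] and nat = nat[rule_format]
  have \<Theta>_closed: "fst (\<Theta> W n x) \<in> H W X n \<and> snd (\<Theta> W n x) \<in> H W X (n + u)"
    if "W \<in> DObj A" "x \<in> H W C n" for W n x
    using iso[OF that(1), of n] that(2)
    by (auto simp: iso_def hom_def Pi_def cone_group_def DirProd_def mem_Times_iff)
  have \<Theta>_mult: "\<Theta> W n (x \<otimes>\<^bsub>DHom A W C n\<^esub> y) =
      (fst (\<Theta> W n x) \<otimes>\<^bsub>DHom A W X n\<^esub> fst (\<Theta> W n y),
       snd (\<Theta> W n x) \<otimes>\<^bsub>DHom A W X (n + u)\<^esub> snd (\<Theta> W n y))"
    if "W \<in> DObj A" "x \<in> H W C n" "y \<in> H W C n" for W n x y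
    using iso[OF that(1), of n] that(2-)
    by (auto simp: iso_def hom_def Pi_def cone_group_def DirProd_def mem_Times_iff split_beta)
  have inj: "x = y" if "\<Theta> W n x = \<Theta> W n y" "W \<in> DObj A" "x \<in> H W C n" "y \<in> H W C n" for W n x y
    using iso[OF that(2), of n] that by (auto simp: iso_def bij_betw_def inj_on_def)
  have surj: "\<exists>x \<in> H W C n. \<Theta> W n x = (l, k)"
    if "W \<in> DObj A" "l \<in> H W X n" "k \<in> H W X (n + u)" for W n l k
  proof -
    have "(l, k) \<in> \<Theta> W n ` H W C n"
      using iso[OF that(1), of n] that by (auto simp: iso_def bij_betw_def cone_group_def DirProd_def)
    then show ?thesis by force
  qed
  have dif': "\<Theta> W m (DDif A W C n x) = (DDif A W X n (fst (\<Theta> W n x)) \<otimes>\<^bsub>DHom A W X m\<^esub> snd (\<Theta> W n x),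
      inv\<^bsub>DHom A W X (m + u)\<^esub> DDif A W X m (snd (\<Theta> W n x)))"
    if "W \<in> DObj A" "x \<in> H W C n" "m = n + u" for W n m x
    using dif[OF that(1,2)] \<Theta>_closed[OF that(1,2)] that
    by (simp add: cone_dif_def split_beta DComp_DId_left X)
  have one: "\<Theta> W n \<one>\<^bsub>DHom A W C n\<^esub> = (\<one>\<^bsub>DHom A W X n\<^esub>, \<one>\<^bsub>DHom A W X (n + u)\<^esub>)"
    if "W \<in> DObj A" for W n
  proof -
    interpret WC: comm_group "DHom A W C n" using that C by (intro DHom_group)
    interpret a: comm_group "DHom A W X n" using that X by (intro DHom_group)
    interpret b: comm_group "DHom A W X (n + u)" using that X by (intro DHom_group)
    show ?thesis
      using \<Theta>_mult[OF that WC.one_closed WC.one_closed, simplified]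
        \<Theta>_closed[OF that WC.one_closed]
      by (metis a.l_cancel_one' b.l_cancel_one' fst_conv snd_conv prod.collapse)
  qed
  interpret XX: comm_group "DHom A X X (-u)" by (rule DHom_group[OF X X])
  interpret XX0: comm_group "DHom A X X 0" by (rule DHom_group[OF X X])
  interpret XXu: comm_group "DHom A X X u" by (rule DHom_group[OF X X])
  interpret XXuu: comm_group "DHom A X X (u + u)" by (rule DHom_group[OF X X])
  interpret CX0: comm_group "DHom A C X 0" by (rule DHom_group[OF C X])
  interpret CXu: comm_group "DHom A C X u" by (rule DHom_group[OF C X])
  interpret CXuu: comm_group "DHom A C X (u + u)" by (rule DHom_group[OF C X])
  interpret CC: comm_group "DHom A C C 0" by (rule DHom_group[OF C C])
  interpret XCu: comm_group "DHom A X C u" by (rule DHom_group[OF X C])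
  note idX = DId_closed[OF X] and idC = DId_closed[OF C]
  obtain i where i: "i \<in> H X C 0" and \<Theta>i: "\<Theta> X 0 i = (DId A X, \<one>\<^bsub>DHom A X X u\<^esub>)"
    using surj[OF X idX, of "\<one>\<^bsub>DHom A X X u\<^esub>"] by auto
  obtain j where j: "j \<in> H X C (- u)" and \<Theta>j: "\<Theta> X (- u) j = (\<one>\<^bsub>DHom A X X (- u)\<^esub>, DId A X)"
    using surj[of X "\<one>\<^bsub>DHom A X X (- u)\<^esub>" "- u" "DId A X"] idX X by auto
  define p where "p = fst (\<Theta> C 0 (DId A C))"
  define q where "q = snd (\<Theta> C 0 (DId A C))"
  have \<Theta>id: "\<Theta> C 0 (DId A C) = (p, q)" by (simp add: p_def q_def)
  have p: "p \<in> H C X 0" and q: "q \<in> H C X u"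
    using \<Theta>_closed[OF C idC] by (simp_all add: \<Theta>id)
  have "\<Theta> C u (DDif A C C 0 (DId A C)) = (\<one>\<^bsub>DHom A C X u\<^esub>, \<one>\<^bsub>DHom A C X (u + u)\<^esub>)"
    by (simp add: DDif_DId C one)
  then have dp: "DDif A C X 0 p \<otimes>\<^bsub>DHom A C X u\<^esub> q = \<one>\<^bsub>DHom A C X u\<^esub>"
    and dq: "DDif A C X u q = \<one>\<^bsub>DHom A C X (u + u)\<^esub>"
    using dif'[OF C idC, of u] dif_closed[OF C X q, of "u + u"] by (simp_all add: \<Theta>id)
  have di: "DDif A X C 0 i = \<one>\<^bsub>DHom A X C u\<^esub>"
  proof (rule inj[OF _ X])
    show "\<Theta> X u (DDif A X C 0 i) = \<Theta> X u \<one>\<^bsub>DHom A X C u\<^esub>"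
      by (simp add: dif'[OF X i] \<Theta>i one X DDif_DId dif_zero)
  qed (use i in \<open>simp_all add: dif_closed X C\<close>)
  have dj: "DDif A X C (- u) j = i"
  proof (rule inj[OF _ X])
    show "\<Theta> X 0 (DDif A X C (- u) j) = \<Theta> X 0 i"
      using idX by (simp add: dif'[OF X j] \<Theta>i \<Theta>j DDif_DId dif_zero X)
  qed (use i j in \<open>simp_all add: dif_closed X C\<close>)
  have cols: "\<Theta> W m x = (DComp A W C X 0 m p x, DComp A W C X u m q x)"
    if "W \<in> DObj A" "x \<in> H W C m" for W m x
    using nat[OF C that(1) idC that(2)] by (simp add: DComp_DId_left that C \<Theta>id)
  have ip: "DComp A C X C 0 0 i p \<in> H C C 0" and jq: "DComp A C X C (- u) u j q \<in> H C C 0"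
    using i j p q X C by (simp_all add: comp_closed)
  have "DComp A C X C 0 0 i p \<otimes>\<^bsub>DHom A C C 0\<^esub> DComp A C X C (- u) u j q = DId A C"
  proof (rule inj[OF _ C])
    have "\<Theta> C 0 (DComp A C X C 0 0 i p) = (p, \<one>\<^bsub>DHom A C X u\<^esub>)"
      using nat[OF X C i p] by (simp add: \<Theta>i DComp_DId_left comp_zero_left X C p)
    moreover have "\<Theta> C 0 (DComp A C X C (- u) u j q) = (\<one>\<^bsub>DHom A C X 0\<^esub>, q)"
      using nat[OF X C j q] by (simp add: \<Theta>j DComp_DId_left comp_zero_left X C q)
    ultimately show "\<Theta> C 0 (DComp A C X C 0 0 i p \<otimes>\<^bsub>DHom A C C 0\<^esub> DComp A C X C (- u) u j q)
        = \<Theta> C 0 (DId A C)"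
      using p q by (simp add: \<Theta>_mult[OF C ip jq] \<Theta>id)
  qed (use ip jq idC in simp_all)
  moreover have "DComp A X C X 0 0 p i = DId A X"
    using cols[OF X i] \<Theta>i by simp
  moreover have "DComp A X C X 0 (- u) p j = \<one>\<^bsub>DHom A X X (- u)\<^esub>" "DComp A X C X u (- u) q j = DId A X"
    using cols[OF X j] \<Theta>j by simp_all
  ultimately have "identity_cone \<sigma> u A X C p q i j"
    using X C p q i j dp dq di dj by unfold_locales
  then show ?thesis by blast
qed

context identity_cone
begin

text \<open>
  \<open>C\<close> is free on the element \<open>j\<close>: a closed \<open>f\<close> with \<open>f j = h\<close> also has \<open>f i = f (d j) = d h\<close>, so
  the decomposition of \<open>C\<close> leaves only \<open>f = (d h) p + h q\<close>.
\<close>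

lemma closed_extension:
  assumes W: "W \<in> DObj A" and h: "h \<in> H X W (- u)"
  shows "\<exists>!f. f \<in> Z C W \<and> DComp A X C W 0 (- u) f j = h"
proof -
  interpret CW: comm_group "DHom A C W 0" by (rule DHom_group[OF C W])
  interpret XW: comm_group "DHom A X W (- u)" by (rule DHom_group[OF X W])
  define dh where "dh = DDif A X W (- u) h"
  have dh: "dh \<in> H X W 0" using dif_closed[OF X W h] by (simp add: dh_def)
  have ddh: "DDif A X W 0 dh = \<one>\<^bsub>DHom A X W u\<^esub>" using dif_dif[OF X W h, of 0] by (simp add: dh_def)
  define f where "f = DComp A C X W 0 0 dh p \<otimes>\<^bsub>DHom A C W 0\<^esub> DComp A C X W (- u) u h q"
  note cl = comp_closed dif_closed X C W p q i j dh h
  have f: "f \<in> H C W 0" by (simp add: f_def cl)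
  have "DDif A C W 0 (DComp A C X W 0 0 dh p) = DComp A C X W 0 u dh (DDif A C X 0 p)"
    using Leibniz_closed_left[OF C X W _ p, of dh] dh ddh by (simp add: Z_iff)
  moreover have "DDif A C W 0 (DComp A C X W (- u) u h q) = DComp A C X W 0 u dh q"
    using Leibniz_closed_right[OF C X W h q] dif_q by (simp add: dh_def)
  ultimately have "DDif A C W 0 f = DComp A C X W 0 u dh (DDif A C X 0 p \<otimes>\<^bsub>DHom A C X u\<^esub> q)"
    by (simp add: f_def dif_add comp_add_right cl)
  then have fZ: "f \<in> Z C W"
    using f by (simp add: dif_p comp_zero_right Z_iff cl)
  have "DComp A X C W 0 (- u) (DComp A C X W 0 0 dh p) j = \<one>\<^bsub>DHom A X W (- u)\<^esub>"
    using DComp_assoc[OF X C X W j p dh] by (simp add: p_j comp_zero_right cl)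
  moreover have "DComp A X C W 0 (- u) (DComp A C X W (- u) u h q) j = h"
    using DComp_assoc[OF X C X W j q h] by (simp add: q_j DComp_DId_right cl)
  ultimately have fj: "DComp A X C W 0 (- u) f j = h"
    by (simp add: f_def comp_add_left cl)
  have unique: "f' = f" if f': "f' \<in> Z C W" and f'j: "DComp A X C W 0 (- u) f' j = h" for f'
  proof -
    have f'H: "f' \<in> H C W 0" using f' by (simp add: Z_iff)
    have "DComp A X C W 0 0 f' i = dh"
      using Leibniz_closed_left[OF X C W f' j] f'j by (simp add: dif_j dh_def)
    then have "DComp A C C W 0 0 f' (DComp A C X C 0 0 i p) = DComp A C X W 0 0 dh p"
      using DComp_assoc[OF C X C W p i f'H] by simp
    moreover have "DComp A C C W 0 0 f' (DComp A C X C (- u) u j q) = DComp A C X W (- u) u h q"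
      using DComp_assoc[OF C X C W q j f'H] f'j by simp
    ultimately have "DComp A C C W 0 0 f' (DId A C) = f"
      by (simp add: decomposition[symmetric] comp_add_right f'H cl f_def)
    then show ?thesis by (simp add: DComp_DId_right f'H C W)
  qed
  show ?thesis
    using fZ fj unique by blast
qed

text \<open>
  \<open>i x - j (d x)\<close> is the only closed morphism to \<open>C\<close> whose composite with \<open>p\<close> is \<open>x\<close>, because
  composition with \<open>q = - d p\<close> then has to give \<open>- d x\<close>.
\<close>

definition lift :: "'o \<Rightarrow> 'm \<Rightarrow> 'm" where
  "lift W x = DComp A W X C 0 0 i x \<otimes>\<^bsub>DHom A W C 0\<^esub>
     inv\<^bsub>DHom A W C 0\<^esub> DComp A W X C (- u) u j (DDif A W X 0 x)"

lemma lift_closed: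
  assumes W: "W \<in> DObj A" and x: "x \<in> H W X 0"
  shows "lift W x \<in> Z W C"
proof -
  interpret WC: comm_group "DHom A W C 0" by (rule DHom_group[OF W C])
  interpret WCu: comm_group "DHom A W C u" by (rule DHom_group[OF W C])
  have dx: "DDif A W X 0 x \<in> H W X u" using W x X by (simp add: dif_closed)
  note cl = comp_closed dif_closed X C W p q i j x dx
  have "DDif A W C 0 (DComp A W X C 0 0 i x) = DComp A W X C 0 u i (DDif A W X 0 x)"
    using Leibniz_closed_left[OF W X C _ x, of i] i dif_i by (simp add: Z_iff)
  moreover have "DDif A W C 0 (DComp A W X C (- u) u j (DDif A W X 0 x)) =
      DComp A W X C 0 u i (DDif A W X 0 x)"
    using Leibniz_closed_right[OF W X C j dx] dif_dif[OF W X x, of u] dif_j by simp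
  ultimately show ?thesis
    by (simp add: Z_iff lift_def dif_add dif_neg cl)
qed

lemma p_lift:
  assumes W: "W \<in> DObj A" and x: "x \<in> H W X 0"
  shows "DComp A W C X 0 0 p (lift W x) = x"
proof -
  interpret WC: comm_group "DHom A W C 0" by (rule DHom_group[OF W C])
  interpret WX: comm_group "DHom A W X 0" by (rule DHom_group[OF W X])
  have dx: "DDif A W X 0 x \<in> H W X u" using W x X by (simp add: dif_closed)
  note cl = comp_closed dif_closed X C W p q i j x dx
  have "DComp A W C X 0 0 p (DComp A W X C 0 0 i x) = x"
    using DComp_assoc[OF W X C X x i p] by (simp add: p_i DComp_DId_left cl)
  moreover have "DComp A W C X 0 0 p (DComp A W X C (- u) u j (DDif A W X 0 x)) = \<one>\<^bsub>DHom A W X 0\<^esub>"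
    using DComp_assoc[OF W X C X dx j p] by (simp add: p_j comp_zero_left cl)
  ultimately show ?thesis
    by (simp add: lift_def comp_add_right comp_neg_right cl)
qed

text \<open>
  The section is \<open>t = i + j a\<close>.  Since \<open>j\<close> has odd degree, \<open>d t = i a - j (d a)\<close>, and the
  equation \<open>d a = - a\<^sup>2\<close> of the twisting element turns this into \<open>i a + j a\<^sup>2 = t a\<close>.
\<close>

lemma twisted_section:
  assumes a: "twisting_element u A X a"
  shows "\<exists>t\<in>H X C 0. DDif A X C 0 t = DComp A X X C 0 u t a \<and> DComp A X C X 0 0 p t = DId A X"
proof -
  interpret XXuu: comm_group "DHom A X X (u + u)" by (rule DHom_group[OF X X])
  interpret XX: comm_group "DHom A X X 0" by (rule DHom_group[OF X X])
  interpret XC: comm_group "DHom A X C 0" by (rule DHom_group[OF X C])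
  interpret XCu: comm_group "DHom A X C u" by (rule DHom_group[OF X C])
  have aH: "a \<in> H X X u" using a unfolding twisting_element_def by blast
  note cl = comp_closed dif_closed X C p q i j aH
  have da: "DDif A X X u a \<in> H X X (u + u)" and aa: "DComp A X X X u u a a \<in> H X X (u + u)"
    by (simp_all add: cl)
  have "DComp A X X X u u a a \<otimes>\<^bsub>DHom A X X (u + u)\<^esub> DDif A X X u a = \<one>\<^bsub>DHom A X X (u + u)\<^esub>"
    using a XXuu.m_comm[OF aa da] unfolding twisting_element_def by metis
  then have neg_da: "inv\<^bsub>DHom A X X (u + u)\<^esub> DDif A X X u a = DComp A X X X u u a a"
    by (rule XXuu.inv_equality[OF _ da aa])
  define t where "t = i \<otimes>\<^bsub>DHom A X C 0\<^esub> DComp A X X C (- u) u j a"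
  have t: "t \<in> H X C 0" by (simp add: t_def cl)
  have "inv\<^bsub>DHom A X C u\<^esub> DComp A X X C (- u) (u + u) j (DDif A X X u a) =
      DComp A X X C (- u) (u + u) j (DComp A X X X u u a a)"
    using comp_neg_right[OF X X C j da, of u] by (simp add: neg_da)
  also have "\<dots> = DComp A X X C 0 u (DComp A X X C (- u) u j a) a"
    using DComp_assoc[OF X X X C aH aH j] by simp
  finally have "DDif A X C 0 (DComp A X X C (- u) u j a) =
      DComp A X X C 0 u i a \<otimes>\<^bsub>DHom A X C u\<^esub> DComp A X X C 0 u (DComp A X X C (- u) u j a) a"
    using Leibniz_minus_u[OF X X C j aH] by (simp add: dif_j)
  then have dt: "DDif A X C 0 t = DComp A X X C 0 u t a"
    by (simp add: t_def dif_add comp_add_left dif_i cl)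
  have "DComp A X C X 0 0 p (DComp A X X C (- u) u j a) = \<one>\<^bsub>DHom A X X 0\<^esub>"
    using DComp_assoc[OF X X C X aH j p] by (simp add: p_j comp_zero_left cl)
  then have "DComp A X C X 0 0 p t = DId A X"
    by (simp add: t_def comp_add_right p_i DId_closed cl)
  with t dt show ?thesis by blast
qed

end

section \<open>Free closed morphisms\<close>

context dg_category
begin

lemma exists_identity_cone:
  assumes "has_cones u A" "X \<in> DObj A"
  shows "\<exists>C p q i j. identity_cone \<sigma> u A X C p q i j"
proof -
  have "DId A X \<in> carrier (closed_hom u A X X 0)"
    using assms(2) by (simp add: Z_iff DId_closed DDif_DId)
  then obtain C where "is_cone u A X X (DId A X) C"
    using assms unfolding has_cones_def by blast
  then show ?thesis using identity_cone_if_is_cone assms(2) by blast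
qed

definition free_on :: "'o \<Rightarrow> 'o \<Rightarrow> 'm \<Rightarrow> bool" where
  "free_on X G \<iota> \<longleftrightarrow> G \<in> DObj A \<and> \<iota> \<in> H X G 0 \<and>
    (\<forall>W\<in>DObj A. \<forall>f\<in>H X W 0. \<exists>!f'. f' \<in> Z G W \<and> DComp A X G W 0 0 f' \<iota> = f)"

lemma exists_unshift:
  assumes "has_shifts u A" "X \<in> DObj A"
  obtains X' r s where "X' \<in> DObj A" "r \<in> H X X' u" "s \<in> H X' X (- u)"
    "DComp A X X' X (- u) u s r = DId A X" "DComp A X' X X' u (- u) r s = DId A X'"
  using assms unfolding has_shifts_def is_shift_def
  by (force simp: closed_hom_def dest!: bspec[where x = X] spec[where x = "- u"])

text \<open>
  The cone of the identity of any \<open>X'\<close> is free on an element \<open>j\<close> of degree \<open>- u\<close>.  For \<open>X'\<close> the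
  shift of \<open>X\<close> by \<open>- u\<close>, composing \<open>j\<close> with the closed isomorphism \<open>X \<rightarrow> X'\<close> of degree \<open>u\<close>
  moves the generator to degree zero.
\<close>

lemma exists_free:
  assumes sh: "has_shifts u A" and co: "has_cones u A" and X: "X \<in> DObj A"
  shows "\<exists>G \<iota>. free_on X G \<iota>"
proof -
  obtain X' r s where X': "X' \<in> DObj A" and r: "r \<in> H X X' u" and s: "s \<in> H X' X (- u)"
    and sr: "DComp A X X' X (- u) u s r = DId A X" and rs: "DComp A X' X X' u (- u) r s = DId A X'"
    using exists_unshift[OF sh X] by blast
  obtain G p q i j where "identity_cone \<sigma> u A X' G p q i j"
    using exists_identity_cone[OF co X'] by blast
  then interpret cone: identity_cone \<sigma> u A X' G p q i j .
  note G = cone.C and j = cone.j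
  define \<iota> where "\<iota> = DComp A X X' G (- u) u j r"
  have \<iota>: "\<iota> \<in> H X G 0" by (simp add: \<iota>_def comp_closed[OF X X' G j r])
  have "\<exists>!f'. f' \<in> Z G W \<and> DComp A X G W 0 0 f' \<iota> = f" if W: "W \<in> DObj A" and f: "f \<in> H X W 0" for W f
  proof -
    have fs: "DComp A X' X W 0 (- u) f s \<in> H X' W (- u)" by (simp add: comp_closed[OF X' X W f s])
    have "DComp A X G W 0 0 f' \<iota> = f \<longleftrightarrow> DComp A X' G W 0 (- u) f' j = DComp A X' X W 0 (- u) f s"
      (is "?L = f \<longleftrightarrow> ?R = ?fs") if "f' \<in> Z G W" for f'
    proof -
      have f': "f' \<in> H G W 0" using that by (simp add: Z_iff)
      have R: "?R \<in> H X' W (- u)" by (simp add: comp_closed[OF X' G W f' j])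
      have L: "?L = DComp A X X' W (- u) u ?R r"
        using DComp_assoc[OF X X' G W r j f'] by (simp add: \<iota>_def)
      have "DComp A X X' W (- u) u ?fs r = f"
        using DComp_assoc[OF X X' X W r s f] by (simp add: sr DComp_DId_right X W f)
      moreover have "DComp A X' X W 0 (- u) ?L s = ?R"
        using DComp_assoc[OF X' X X' W s r R] by (simp add: L rs DComp_DId_right X' W R)
      ultimately show ?thesis using L by metis
    qed
    with cone.closed_extension[OF W fs] show ?thesis
      by (metis (no_types, lifting))
  qed
  then show ?thesis using G \<iota> unfolding free_on_def by blast
qed

section \<open>Twists\<close>

text \<open>
  \<open>Y\<close> is the quotient of the free object \<open>G\<close> on \<open>\<iota>\<close> by \<open>\<delta> = d \<iota> - \<iota> a\<close>.  To form it as a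
  cokernel, the degree \<open>u\<close> element \<open>\<delta> : X \<rightarrow> G\<close> has to be turned into a closed morphism of degree
  zero: it is first moved to degree zero by a shift \<open>X'\<close> of \<open>X\<close> and then extended to a closed
  \<open>w\<close> from the free object on \<open>X'\<close>.  A closed \<open>t\<close> kills \<open>w\<close> iff it kills \<open>\<delta>\<close>, that is,
  iff \<open>d (t \<iota>) = (t \<iota>) a\<close>.
\<close>

lemma twist_classifier:
  assumes sh: "has_shifts u A" and co: "has_cones u A"
    and coker: "\<And>X Y f. \<lbrakk>X \<in> DObj A; Y \<in> DObj A; f \<in> Z X Y\<rbrakk> \<Longrightarrow> \<exists>Q q. is_cokernel (Z0 u A) X Y f Q q"
    and X: "X \<in> DObj A" and a: "twisting_element u A X a"
  shows "\<exists>Y\<in>DObj A. \<exists>f\<in>H X Y 0. DDif A X Y 0 f = DComp A X X Y 0 u f a \<and>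
    (\<forall>W\<in>DObj A. \<forall>t\<in>H X W 0. DDif A X W 0 t = DComp A X X W 0 u t a \<longrightarrow>
      (\<exists>!t'. t' \<in> Z Y W \<and> DComp A X Y W 0 0 t' f = t))"
proof -
  have aH: "a \<in> H X X u" using a unfolding twisting_element_def by blast
  obtain X' r s where X': "X' \<in> DObj A" and r: "r \<in> H X X' u" and s: "s \<in> H X' X (- u)"
    and sr: "DComp A X X' X (- u) u s r = DId A X"
    using exists_unshift[OF sh X] by blast
  obtain G \<iota> where "free_on X G \<iota>" using exists_free[OF sh co X] by blast
  then have G: "G \<in> DObj A" and \<iota>: "\<iota> \<in> H X G 0"
    and free: "\<And>W f. \<lbrakk>W \<in> DObj A; f \<in> H X W 0\<rbrakk> \<Longrightarrow> \<exists>!f'. f' \<in> Z G W \<and> DComp A X G W 0 0 f' \<iota> = f"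
    unfolding free_on_def by blast+
  obtain G' \<iota>' where "free_on X' G' \<iota>'" using exists_free[OF sh co X'] by blast
  then have G': "G' \<in> DObj A" and \<iota>': "\<iota>' \<in> H X' G' 0"
    and free': "\<And>W f. \<lbrakk>W \<in> DObj A; f \<in> H X' W 0\<rbrakk> \<Longrightarrow> \<exists>!f'. f' \<in> Z G' W \<and> DComp A X' G' W 0 0 f' \<iota>' = f"
    unfolding free_on_def by blast+
  interpret XGu: comm_group "DHom A X G u" by (rule DHom_group[OF X G])
  note cl = comp_closed dif_closed X X' G G' aH r s \<iota> \<iota>'
  define \<delta> where "\<delta> = DDif A X G 0 \<iota> \<otimes>\<^bsub>DHom A X G u\<^esub> inv\<^bsub>DHom A X G u\<^esub> DComp A X X G 0 u \<iota> a"
  have \<delta>: "\<delta> \<in> H X G u" by (simp add: \<delta>_def cl)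
  have \<delta>s: "DComp A X' X G u (- u) \<delta> s \<in> H X' G 0" by (simp add: \<delta> cl)
  then obtain w where w: "w \<in> Z G' G" and w\<iota>': "DComp A X' G' G 0 0 w \<iota>' = DComp A X' X G u (- u) \<delta> s"
    using free'[OF G \<delta>s] by blast
  have t_\<delta>: "DComp A X G W 0 u t \<delta> = \<one>\<^bsub>DHom A X W u\<^esub> \<longleftrightarrow>
      DDif A X W 0 (DComp A X G W 0 0 t \<iota>) = DComp A X X W 0 u (DComp A X G W 0 0 t \<iota>) a"
    if W: "W \<in> DObj A" and t: "t \<in> Z G W" for W t
  proof -
    interpret XWu: comm_group "DHom A X W u" by (rule DHom_group[OF X W])
    have tH: "t \<in> H G W 0" using t by (simp add: Z_iff)
    let ?x = "DDif A X W 0 (DComp A X G W 0 0 t \<iota>)"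
    let ?y = "DComp A X X W 0 u (DComp A X G W 0 0 t \<iota>) a"
    have x: "?x \<in> H X W u" and y: "?y \<in> H X W u" by (simp_all add: cl W tH)
    have "DComp A X G W 0 u t \<delta> = ?x \<otimes>\<^bsub>DHom A X W u\<^esub> inv\<^bsub>DHom A X W u\<^esub> ?y"
      using Leibniz_closed_left[OF X G W t \<iota>] DComp_assoc[OF X X G W aH \<iota> tH]
      by (simp add: \<delta>_def comp_add_right[where k = u] comp_neg_right[where k = u] cl W tH)
    then show ?thesis using x y
      by (metis XWu.inv_closed XWu.inv_equality XWu.inv_inv XWu.r_inv)
  qed
  have t_w: "DComp A G' G W 0 0 t w = \<one>\<^bsub>DHom A G' W 0\<^esub> \<longleftrightarrow> DComp A X G W 0 u t \<delta> = \<one>\<^bsub>DHom A X W u\<^esub>"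
    (is "?tw = _ \<longleftrightarrow> ?t\<delta> = _") if W: "W \<in> DObj A" and t: "t \<in> Z G W" for W t
  proof -
    interpret G'W: comm_group "DHom A G' W 0" by (rule DHom_group[OF G' W])
    have tH: "t \<in> H G W 0" and wH: "w \<in> H G' G 0" using t w by (simp_all add: Z_iff)
    have t\<delta>: "?t\<delta> \<in> H X W u" by (simp add: cl W tH \<delta>)
    have tw_closed: "?tw \<in> Z G' W" by (rule Z_comp[OF G' G W t w])
    have zero: "\<one>\<^bsub>DHom A G' W 0\<^esub> \<in> Z G' W" by (simp add: Z_iff dif_zero G' W)
    have "DComp A X' G' W 0 0 ?tw \<iota>' = DComp A X' X W u (- u) ?t\<delta> s"
      using DComp_assoc[OF X' G' G W \<iota>' wH tH] DComp_assoc[OF X' X G W s \<delta> tH] by (simp add: w\<iota>')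
    moreover have "DComp A X X' W 0 u (DComp A X' X W u (- u) ?t\<delta> s) r = ?t\<delta>"
      using DComp_assoc[OF X X' X W r s t\<delta>] by (simp add: sr DComp_DId_right X W t\<delta>)
    moreover have "DComp A X' X W u (- u) \<one>\<^bsub>DHom A X W u\<^esub> s = \<one>\<^bsub>DHom A X' W 0\<^esub>"
      "DComp A X X' W 0 u \<one>\<^bsub>DHom A X' W 0\<^esub> r = \<one>\<^bsub>DHom A X W u\<^esub>"
      "DComp A X' G' W 0 0 \<one>\<^bsub>DHom A G' W 0\<^esub> \<iota>' = \<one>\<^bsub>DHom A X' W 0\<^esub>"
      by (simp_all add: comp_zero_left cl W)
    moreover have "\<one>\<^bsub>DHom A X' W 0\<^esub> \<in> H X' W 0"
      using DHom_group[OF X' W, of 0] by (simp add: comm_group_def comm_monoid_def monoid.one_closed)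
    ultimately show ?thesis using free'[OF W] tw_closed zero by metis
  qed
  obtain Y q where "is_cokernel (Z0 u A) G' G w Y q" using coker[OF G' G w] by blast
  then have Y: "Y \<in> DObj A" and q: "q \<in> Z G Y" and qw: "DComp A G' G Y 0 0 q w = \<one>\<^bsub>DHom A G' Y 0\<^esub>"
    and univ: "\<And>W t. \<lbrakk>W \<in> DObj A; t \<in> Z G W; DComp A G' G W 0 0 t w = \<one>\<^bsub>DHom A G' W 0\<^esub>\<rbrakk>
      \<Longrightarrow> \<exists>!t'. t' \<in> Z Y W \<and> DComp A G Y W 0 0 t' q = t"
    unfolding is_cokernel_def Z0_def by (simp_all add: closed_hom_def)
  have qH: "q \<in> H G Y 0" using q by (simp add: Z_iff)
  define f where "f = DComp A X G Y 0 0 q \<iota>"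
  have f: "f \<in> H X Y 0" by (simp add: f_def cl Y qH)
  have df: "DDif A X Y 0 f = DComp A X X Y 0 u f a"
    using t_w[OF Y q] t_\<delta>[OF Y q] qw by (simp add: f_def)
  have "\<exists>!t'. t' \<in> Z Y W \<and> DComp A X Y W 0 0 t' f = t"
    if W: "W \<in> DObj A" and t: "t \<in> H X W 0" and dt: "DDif A X W 0 t = DComp A X X W 0 u t a" for W t
  proof -
    obtain b where b: "b \<in> Z G W" and b\<iota>: "DComp A X G W 0 0 b \<iota> = t"
      using free[OF W t] by blast
    have bw: "DComp A G' G W 0 0 b w = \<one>\<^bsub>DHom A G' W 0\<^esub>"
      using t_w[OF W b] t_\<delta>[OF W b] dt b\<iota> by simp
    have "DComp A X Y W 0 0 t' f = t \<longleftrightarrow> DComp A G Y W 0 0 t' q = b" if t': "t' \<in> Z Y W" for t'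
    proof -
      have t'H: "t' \<in> H Y W 0" using t' by (simp add: Z_iff)
      have "DComp A X Y W 0 0 t' f = DComp A X G W 0 0 (DComp A G Y W 0 0 t' q) \<iota>"
        using DComp_assoc[OF X G Y W \<iota> qH t'H] by (simp add: f_def)
      then show ?thesis using free[OF W t] b b\<iota> Z_comp[OF G Y W t' q] by auto
    qed
    with univ[OF W b bw] show ?thesis by (metis (no_types, lifting))
  qed
  then show ?thesis using Y f df by blast
qed

lemma has_twists_if_cokernels:
  assumes sh: "has_shifts u A" and co: "has_cones u A"
    and coker: "\<And>X Y f. \<lbrakk>X \<in> DObj A; Y \<in> DObj A; f \<in> Z X Y\<rbrakk> \<Longrightarrow> \<exists>Q q. is_cokernel (Z0 u A) X Y f Q q"
  shows "has_twists u A"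
  unfolding has_twists_def
proof (intro ballI allI impI)
  fix X a assume X: "X \<in> DObj A" and a: "twisting_element u A X a"
  then have aH: "a \<in> H X X u" unfolding twisting_element_def by blast
  obtain Y f where Y: "Y \<in> DObj A" and f: "f \<in> H X Y 0" and df: "DDif A X Y 0 f = DComp A X X Y 0 u f a"
    and univ: "\<And>W t. \<lbrakk>W \<in> DObj A; t \<in> H X W 0; DDif A X W 0 t = DComp A X X W 0 u t a\<rbrakk> \<Longrightarrow>
      \<exists>!t'. t' \<in> Z Y W \<and> DComp A X Y W 0 0 t' f = t"
    using twist_classifier[OF sh co coker X a] by blast
  have "\<exists>g\<in>H Y X 0. DComp A X Y X 0 0 g f = DId A X"
  proof -
    obtain C p q i j where "identity_cone \<sigma> u A X C p q i j"
      using exists_identity_cone[OF co X] by blast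
    then interpret cone: identity_cone \<sigma> u A X C p q i j .
    note C = cone.C and p = cone.p
    obtain t where t: "t \<in> H X C 0" "DDif A X C 0 t = DComp A X X C 0 u t a"
      and pt: "DComp A X C X 0 0 p t = DId A X"
      using cone.twisted_section[OF a] by blast
    obtain t' where t': "t' \<in> Z Y C" and t'f: "DComp A X Y C 0 0 t' f = t"
      using univ[OF C t] by blast
    have t'H: "t' \<in> H Y C 0" using t' by (simp add: Z_iff)
    show ?thesis
    proof
      show "DComp A Y C X 0 0 p t' \<in> H Y X 0" by (simp add: comp_closed[OF Y C X p t'H])
      show "DComp A X Y X 0 0 (DComp A Y C X 0 0 p t') f = DId A X"
        using DComp_assoc[OF X Y C X f t'H p] by (simp add: t'f pt)
    qed
  qed
  then obtain g where g: "g \<in> H Y X 0" and gf: "DComp A X Y X 0 0 g f = DId A X" by blast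
  \<comment> \<open>Restriction along \<open>f\<close> is injective on all elements of degree zero, closed or not: the equation
      \<open>(d z) f = d (z f) - (z f) a\<close> shows that \<open>z f\<close> determines \<open>(d z) f\<close>, hence determines the
      restriction along \<open>f\<close> of the closed lift of \<open>z\<close>, to which the universal property applies.\<close>
  have epi: "x = y" if W: "W \<in> DObj A" and x: "x \<in> H Y W 0" and y: "y \<in> H Y W 0"
    and eq: "DComp A X Y W 0 0 x f = DComp A X Y W 0 0 y f" for W x y
  proof -
    obtain C p q i j where "identity_cone \<sigma> u A W C p q i j"
      using exists_identity_cone[OF co W] by blast
    then interpret cone: identity_cone \<sigma> u A W C p q i j .
    note C = cone.C and i = cone.i and j = cone.j
    interpret XW: comm_group "DHom A X W u" by (rule DHom_group[OF X W])
    interpret YC: comm_group "DHom A Y C 0" by (rule DHom_group[OF Y C])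
    note cl = comp_closed dif_closed X Y C W f aH x y i j
    have dz: "DComp A X Y W u 0 (DDif A Y W 0 z) f = DDif A X W 0 (DComp A X Y W 0 0 z f)
        \<otimes>\<^bsub>DHom A X W u\<^esub> inv\<^bsub>DHom A X W u\<^esub> DComp A X X W 0 u (DComp A X Y W 0 0 z f) a"
      if z: "z \<in> H Y W 0" for z
      using Leibniz_0[OF X Y W z f] DComp_assoc[OF X X Y W aH f z]
      by (simp add: df XW.m_assoc cl z)
    have lift_f: "DComp A X Y C 0 0 (cone.lift Y z) f =
       DComp A X W C 0 0 i (DComp A X Y W 0 0 z f) \<otimes>\<^bsub>DHom A X C 0\<^esub> inv\<^bsub>DHom A X C 0\<^esub>
        DComp A X W C (- u) u j (DComp A X Y W u 0 (DDif A Y W 0 z) f)" if z: "z \<in> H Y W 0" for z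
    proof -
      have dz: "DDif A Y W 0 z \<in> H Y W u" by (simp add: cl z)
      show ?thesis
        using DComp_assoc[OF X Y W C f z i] DComp_assoc[OF X Y W C f dz j]
        by (simp add: cone.lift_def comp_add_left comp_neg_left cl z dz)
    qed
    let ?m = "DComp A X Y C 0 0 (cone.lift Y x) f"
    have lx: "cone.lift Y x \<in> Z Y C" and ly: "cone.lift Y y \<in> Z Y C"
      using cone.lift_closed[OF Y] x y by blast+
    have lf: "DComp A X Y C 0 0 (cone.lift Y y) f = ?m"
      by (simp only: lift_f[OF x] lift_f[OF y] dz[OF x] dz[OF y] eq)
    have lxH: "cone.lift Y x \<in> H Y C 0" using lx by (simp add: Z_iff)
    have m: "?m \<in> H X C 0" by (simp add: cl lxH)
    have "DDif A X C 0 ?m = DComp A X X C 0 u ?m a"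
      using Leibniz_closed_left[OF X Y C lx f] DComp_assoc[OF X X Y C aH f lxH] by (simp add: df)
    then have "cone.lift Y x = cone.lift Y y"
      using univ[OF C m] lx ly lf by blast
    then show ?thesis using cone.p_lift[OF Y x] cone.p_lift[OF Y y] by metis
  qed
  have "DComp A Y X Y 0 0 f g = DId A Y"
  proof (rule epi[OF Y])
    show "DComp A X Y Y 0 0 (DComp A Y X Y 0 0 f g) f = DComp A X Y Y 0 0 (DId A Y) f"
      using DComp_assoc[OF X Y X Y f g f] by (simp add: gf DComp_DId_left DComp_DId_right X Y f)
  qed (simp_all add: comp_closed X Y f g DId_closed)
  then show "\<exists>Y. is_twist u A X a Y"
    using Y f g gf df unfolding is_twist_def by blast
qed

end

theorem proposition4p36:
  fixes \<sigma> :: "'g::ab_group_add \<Rightarrow> 'g \<Rightarrow> bit" and u :: 'g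
    and A :: "('g, 'o, 'm) dgcat"
  assumes "grading \<sigma> u"
    and "abelian_dg_category \<sigma> u A"
  shows "dg_idempotent_complete u A \<and> has_twists u A"
proof
  have ab: "abelian_category (Z0 u A)" and dg: "dg_category \<sigma> u A"
    and sh: "has_shifts u A" and co: "has_cones u A"
    using assms(2) unfolding abelian_dg_category_def by blast+
  show "dg_idempotent_complete u A"
    unfolding dg_idempotent_complete_def by (rule abelian_category_idempotents_split[OF ab])
  interpret dg_category \<sigma> u A by (rule dg)
  have "\<exists>Q q. is_cokernel (Z0 u A) X Y f Q q"
    if "X \<in> DObj A" "Y \<in> DObj A" "f \<in> carrier (closed_hom u A X Y 0)" for X Y f
    using ab that unfolding abelian_category_def by (simp add: Z0_def)
  then show "has_twists u A" by (rule has_twists_if_cokernels[OF sh co])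
qed

end
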